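(* There exists a countably infinite precompact abelian topological group $H$ such that every quotient group of $H$ is either trivial or non-metrizable.
   Context: All topological groups are assumed to be Hausdorff. A quotient group of a topological group $H$ means $H/N$ with the quotient topology, where $N$ is a closed normal subgroup of $H$ (the case $N=\{e\}$ is allowed). A topological group is precompact if it is (topologically isomorphic to) a subgroup of a compact group; equivalently, for every neighborhood $U$ of the identity the group is covered by finitely many translates of $U$. A group is trivial if it has exactly one element. *)

theory Defs
  imports "HOL-Analysis.Analysis" "HOL-Algebra.Coset"
begin

locale hausdorff_topological_group = group G
  for G (structure) and T :: "'a topology" +
  assumes topspace_carrier: "topspace T = carrier G"
    and continuous_mult: "continuous_map (prod_topology T T) T (\<lambda>(x, y). x \<otimes> y)"
    and continuous_inv: "continuous_map T T (\<lambda>x. inv x)"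
    and hausdorff: "Hausdorff_space T"

text \<open>
  Precompactness is the intrinsic covering property. Being a topological subgroup of some
  compact group would need a quantifier over the types of compact groups. It suffices to
  consider open neighbourhoods of the identity.
\<close>

definition precompact_group :: "('a, 'b) monoid_scheme \<Rightarrow> 'a topology \<Rightarrow> bool" where
  "precompact_group G T \<longleftrightarrow>
     (\<forall>U. openin T U \<and> \<one>\<^bsub>G\<^esub> \<in> U \<longrightarrow>
        (\<exists>F. finite F \<and> F \<subseteq> carrier G \<and> carrier G \<subseteq> (\<Union>x\<in>F. x <#\<^bsub>G\<^esub> U)))"

definition quotient_group_topology ::
    "('a, 'b) monoid_scheme \<Rightarrow> 'a topology \<Rightarrow> 'a set \<Rightarrow> 'a set topology" where
  "quotient_group_topology G T N =
     topology (\<lambda>W. W \<subseteq> carrier (G Mod N) \<and>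
                   openin T {x \<in> topspace T. N #>\<^bsub>G\<^esub> x \<in> W})"

lemma openin_quotient_group_topology:
  "openin (quotient_group_topology G T N) W \<longleftrightarrow>
     W \<subseteq> carrier (G Mod N) \<and> openin T {x \<in> topspace T. N #>\<^bsub>G\<^esub> x \<in> W}"
proof -
  have "istopology (\<lambda>W. W \<subseteq> carrier (G Mod N) \<and>
                        openin T {x \<in> topspace T. N #>\<^bsub>G\<^esub> x \<in> W})"
    unfolding istopology_def
  proof (intro conjI allI impI)
    fix S S'
    assume S: "S \<subseteq> carrier (G Mod N) \<and> openin T {x \<in> topspace T. N #>\<^bsub>G\<^esub> x \<in> S}"
      and S': "S' \<subseteq> carrier (G Mod N) \<and> openin T {x \<in> topspace T. N #>\<^bsub>G\<^esub> x \<in> S'}"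
    have "{x \<in> topspace T. N #>\<^bsub>G\<^esub> x \<in> S \<inter> S'} =
        {x \<in> topspace T. N #>\<^bsub>G\<^esub> x \<in> S} \<inter> {x \<in> topspace T. N #>\<^bsub>G\<^esub> x \<in> S'}"
      by blast
    with S S' show "openin T {x \<in> topspace T. N #>\<^bsub>G\<^esub> x \<in> S \<inter> S'}"
      by (simp add: openin_Int)
    show "S \<inter> S' \<subseteq> carrier (G Mod N)"
      using S by blast
  next
    fix K
    assume K: "\<forall>S\<in>K. S \<subseteq> carrier (G Mod N) \<and> openin T {x \<in> topspace T. N #>\<^bsub>G\<^esub> x \<in> S}"
    have "{x \<in> topspace T. N #>\<^bsub>G\<^esub> x \<in> \<Union>K} =
        (\<Union>S\<in>K. {x \<in> topspace T. N #>\<^bsub>G\<^esub> x \<in> S})"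
      by blast
    with K show "openin T {x \<in> topspace T. N #>\<^bsub>G\<^esub> x \<in> \<Union>K}"
      by auto
    show "\<Union>K \<subseteq> carrier (G Mod N)"
      using K by blast
  qed
  then show ?thesis
    by (simp add: quotient_group_topology_def topology_inverse')
qed

lemma (in hausdorff_topological_group) quotient_map_quotient_group_topology:
  "quotient_map T (quotient_group_topology G T N) (\<lambda>x. N #> x)"
proof -
  have car: "carrier (G Mod N) = (\<lambda>x. N #> x) ` topspace T"
    by (auto simp: FactGroup_def RCOSETS_def topspace_carrier)
  then have "{x \<in> topspace T. N #> x \<in> carrier (G Mod N)} = topspace T"
    by blast
  then have "openin (quotient_group_topology G T N) (carrier (G Mod N))"
    by (simp add: openin_quotient_group_topology)
  then have "topspace (quotient_group_topology G T N) = carrier (G Mod N)"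
    by (meson openin_quotient_group_topology openin_subset openin_topspace subset_antisym)
  then show ?thesis
    by (simp add: quotient_map_def car openin_quotient_group_topology)
qed

end

theory Submission
  imports Defs
begin

text \<open>
  We take the Pruefer 2-group of complex roots of unity of order a power of 2, with the topology
  induced by all its characters, i.e. by the 2-adic integers. It is precompact, being embedded in
  a product of circles. A proper subgroup N is contained in the roots of order at most
  \<open>2 ^ m\<close> for some m. If the quotient by N were first countable, a countable neighbourhood
  base at its identity would pull back to infinite sets \<open>W k\<close>, and these contain elements
  \<open>x k\<close> of strictly increasing orders above \<open>2 ^ m\<close>. Changing one binary digit of a
  2-adic integer changes the sign of its character at a suitable \<open>x k\<close>, so the digits can be
  chosen one after the other to give a character that is trivial on N and has nonpositive real
  part at every \<open>x k\<close>; this contradicts its continuity on the quotient.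
\<close>

section \<open>Topologies induced by characters\<close>

text \<open>The map \<open>\<phi>\<close> embeds the group into a power of the unit circle, one
  coordinate per character.\<close>

locale separating_characters = group G
  for G (structure) +
  fixes \<phi> :: "'a \<Rightarrow> 'i \<Rightarrow> complex"
  assumes char_mult: "\<lbrakk>x \<in> carrier G; y \<in> carrier G\<rbrakk> \<Longrightarrow> \<phi> (x \<otimes> y) i = \<phi> x i * \<phi> y i"
    and norm_char: "x \<in> carrier G \<Longrightarrow> norm (\<phi> x i) = 1"
    and inj_char: "inj_on \<phi> (carrier G)"
begin

text \<open>Functions carry the product topology, so this is the coarsest topology making every
  \<open>\<lambda>x. \<phi> x i\<close> continuous.\<close>

definition char_topology :: "'a topology" where
  "char_topology = pullback_topology (carrier G) \<phi> euclidean"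

lemma topspace_char_topology [simp]: "topspace char_topology = carrier G"
  by (simp add: char_topology_def topspace_pullback_topology)

lemma openin_char_topology:
  "openin char_topology S \<longleftrightarrow> (\<exists>U. open U \<and> S = \<phi> -` U \<inter> carrier G)"
  by (simp add: char_topology_def openin_pullback_topology)

lemma char_one [simp]: "\<phi> \<one> i = 1"
proof -
  have "\<phi> \<one> i * \<phi> \<one> i = \<phi> \<one> i"
    using char_mult[of \<one> \<one> i] by simp
  moreover have "\<phi> \<one> i \<noteq> 0"
    using norm_char[of \<one> i] by auto
  ultimately show ?thesis
    by simp
qed

lemma char_inv:
  assumes "x \<in> carrier G"
  shows "\<phi> (inv x) i = cnj (\<phi> x i)"
proof -
  have "\<phi> x i * \<phi> (inv x) i = 1"
    using char_mult[of x "inv x" i] assms by simp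
  moreover have "cnj (\<phi> x i) * \<phi> x i = 1"
    using norm_char[OF assms, of i] complex_norm_square[of "\<phi> x i"] by (simp add: mult.commute)
  ultimately show ?thesis
    by (metis mult.assoc mult.left_neutral mult.right_neutral)
qed

lemma continuous_map_char: "continuous_map char_topology euclidean (\<lambda>x. \<phi> x i)"
proof -
  have "continuous_map euclidean euclidean (\<lambda>f::'i \<Rightarrow> complex. f i)"
    by simp
  from continuous_map_pullback[OF this, of "carrier G" \<phi>] show ?thesis
    by (simp add: char_topology_def o_def)
qed

text \<open>Universal property of an initial topology: continuity is tested one character at a
  time.\<close>

lemma continuous_map_into_char_topology:
  assumes "\<And>i. continuous_map X euclidean (\<lambda>x. \<phi> (f x) i)"
    and "\<And>x. x \<in> topspace X \<Longrightarrow> f x \<in> carrier G"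
  shows "continuous_map X char_topology f"
  unfolding char_topology_def
proof (rule continuous_map_pullback')
  have "continuous_map X (product_topology (\<lambda>i. euclidean) UNIV) (\<phi> \<circ> f)"
    using assms(1) by (simp add: continuous_map_componentwise_UNIV)
  then show "continuous_map X euclidean (\<phi> \<circ> f)"
    by (simp add: euclidean_product_topology)
qed (use assms(2) in auto)

sublocale hausdorff_topological_group G char_topology
proof
  show "topspace char_topology = carrier G"
    by simp
  have fst: "continuous_map (prod_topology char_topology char_topology) euclidean (\<lambda>x. \<phi> (fst x) i)"
    and snd: "continuous_map (prod_topology char_topology char_topology) euclidean (\<lambda>x. \<phi> (snd x) i)"
    for i
    using continuous_map_compose[OF continuous_map_fst continuous_map_char]
      continuous_map_compose[OF continuous_map_snd continuous_map_char]
    by (simp_all add: o_def)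
  show "continuous_map (prod_topology char_topology char_topology) char_topology (\<lambda>(x, y). x \<otimes> y)"
  proof (rule continuous_map_into_char_topology)
    fix i
    have "continuous_map (prod_topology char_topology char_topology) euclidean
        (\<lambda>x. \<phi> (fst x) i * \<phi> (snd x) i)"
      using fst[of i] snd[of i] by (simp add: continuous_map_atin tendsto_mult)
    then show "continuous_map (prod_topology char_topology char_topology) euclidean
        (\<lambda>x. \<phi> (case x of (x, y) \<Rightarrow> x \<otimes> y) i)"
      by (rule continuous_map_eq) (auto simp: char_mult)
  qed auto
  show "continuous_map char_topology char_topology (\<lambda>x. inv x)"
  proof (rule continuous_map_into_char_topology)
    fix i
    have "continuous_map char_topology euclidean (cnj \<circ> (\<lambda>x. \<phi> x i))"
      by (rule continuous_map_compose[OF continuous_map_char]) (simp add: continuous_intros)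
    then show "continuous_map char_topology euclidean (\<lambda>x. \<phi> (inv x) i)"
      by (rule continuous_map_eq) (auto simp: char_inv)
  qed auto
  have "continuous_map char_topology euclidean \<phi>"
    using continuous_map_pullback[OF continuous_map_id, of "carrier G" \<phi> euclidean]
    by (simp add: char_topology_def)
  moreover have "Hausdorff_space (euclidean :: ('i \<Rightarrow> complex) topology)"
    by (metis Hausdorff_space_product_topology Hausdorff_space_euclidean euclidean_product_topology)
  ultimately show "Hausdorff_space char_topology"
    using Hausdorff_space_injective_preimage[of euclidean char_topology \<phi>] inj_char by simp
qed

text \<open>The image of \<open>\<phi>\<close> lies in a compact power of the circle. Finitely many
  open sets with small quotients cover that power, and each one meeting the image yields one
  translate.\<close>

lemma precompact_char_topology: "precompact_group G char_topology"
  unfolding precompact_group_def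
proof (intro allI impI, elim conjE)
  fix U assume U: "openin char_topology U" and one: "\<one> \<in> U"
  obtain V where V: "open V" and UV: "U = \<phi> -` V \<inter> carrier G"
    using U openin_char_topology by auto
  define K :: "('i \<Rightarrow> complex) set" where "K = (\<Pi>\<^sub>E i\<in>UNIV. sphere 0 1)"
  have "compact K"
  proof -
    have "compactin (product_topology (\<lambda>i::'i. euclidean) UNIV) K"
      unfolding K_def compactin_PiE by simp
    then show ?thesis
      by (simp add: euclidean_product_topology)
  qed
  \<comment> \<open>\<open>d\<close> extends \<open>inv x \<otimes> y\<close> from the image of
    \<open>\<phi>\<close> to all pairs; conjugation is inversion on the circle.\<close>
  define d :: "('i \<Rightarrow> complex) \<times> ('i \<Rightarrow> complex) \<Rightarrow> 'i \<Rightarrow> complex"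
    where "d = (\<lambda>(p, q) i. cnj (p i) * q i)"
  have contd: "continuous_on UNIV d"
    unfolding d_def case_prod_unfold
  proof (rule continuous_on_coordinatewise_then_product)
    fix i :: 'i
    have "continuous_on UNIV (\<lambda>x::('i \<Rightarrow> complex) \<times> ('i \<Rightarrow> complex). fst x i)"
      by (rule continuous_on_product_then_coordinatewise[OF continuous_on_fst[OF continuous_on_id]])
    moreover have "continuous_on UNIV (\<lambda>x::('i \<Rightarrow> complex) \<times> ('i \<Rightarrow> complex). snd x i)"
      by (rule continuous_on_product_then_coordinatewise[OF continuous_on_snd[OF continuous_on_id]])
    ultimately show "continuous_on UNIV
        (\<lambda>x::('i \<Rightarrow> complex) \<times> ('i \<Rightarrow> complex). cnj (fst x i) * snd x i)"
      by (intro continuous_on_mult continuous_on_cnj)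
  qed
  have d_char: "d (\<phi> x, \<phi> y) = \<phi> (inv x \<otimes> y)" if "x \<in> carrier G" "y \<in> carrier G" for x y
    using that by (auto simp: d_def char_mult char_inv)
  \<comment> \<open>On the diagonal of \<open>K\<close> the map \<open>d\<close> takes the value
    \<open>\<phi> \<one>\<close>, which lies in the open set \<open>V\<close>.\<close>
  have nbhd: "\<exists>O'. open O' \<and> p \<in> O' \<and> O' \<times> O' \<subseteq> d -` V" if "p \<in> K" for p
  proof -
    have "d (p, p) = \<phi> \<one>"
    proof
      fix i
      have "norm (p i) = 1"
        using that by (auto simp: K_def)
      then show "d (p, p) i = \<phi> \<one> i"
        using complex_norm_square[of "p i"] by (simp add: d_def mult.commute)
    qed
    then have "(p, p) \<in> d -` V"
      using one UV by simp
    with open_vimage[OF V contd] obtain A B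
      where "open A" "open B" "(p, p) \<in> A \<times> B" "A \<times> B \<subseteq> d -` V"
      by (rule open_prod_elim)
    then show ?thesis
      by (intro exI[of _ "A \<inter> B"]) auto
  qed
  then obtain N where N: "\<And>p. p \<in> K \<Longrightarrow> open (N p) \<and> p \<in> N p \<and> N p \<times> N p \<subseteq> d -` V"
    by metis
  have "K \<subseteq> (\<Union>p\<in>K. N p)"
    using N by blast
  with N obtain C where C: "C \<subseteq> K" "finite C" "K \<subseteq> (\<Union>p\<in>C. N p)"
    using compactE_image[OF \<open>compact K\<close>, of K N] by metis
  \<comment> \<open>A centre \<open>p\<close> need not come from the group, so it is replaced by
    some \<open>r p\<close> with \<open>\<phi> (r p)\<close> in \<open>N p\<close>.\<close>
  define C' where "C' = {p \<in> C. \<exists>x\<in>carrier G. \<phi> x \<in> N p}"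
  have "\<forall>p\<in>C'. \<exists>x. x \<in> carrier G \<and> \<phi> x \<in> N p"
    by (auto simp: C'_def)
  from bchoice[OF this] obtain r where r: "\<And>p. p \<in> C' \<Longrightarrow> r p \<in> carrier G \<and> \<phi> (r p) \<in> N p"
    by blast
  show "\<exists>F. finite F \<and> F \<subseteq> carrier G \<and> carrier G \<subseteq> (\<Union>x\<in>F. x <# U)"
  proof (intro exI conjI)
    show "finite (r ` C')"
      using C by (simp add: C'_def)
    show "r ` C' \<subseteq> carrier G"
      using r by auto
    show "carrier G \<subseteq> (\<Union>x\<in>r ` C'. x <# U)"
    proof
      fix y assume y: "y \<in> carrier G"
      then have "\<phi> y \<in> K"
        by (auto simp: K_def PiE_iff norm_char)
      then obtain p where p: "p \<in> C" "\<phi> y \<in> N p"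
        using C by auto
      then have p': "p \<in> C'"
        using y by (auto simp: C'_def)
      then have rp: "r p \<in> carrier G" "\<phi> (r p) \<in> N p"
        using r by auto
      have "d (\<phi> (r p), \<phi> y) \<in> V"
        using N[of p] p rp C by blast
      then have "inv (r p) \<otimes> y \<in> U"
        using UV d_char y rp by simp
      moreover have "y = r p \<otimes> (inv (r p) \<otimes> y)"
        using y rp by (simp add: m_assoc[symmetric])
      ultimately show "y \<in> (\<Union>x\<in>r ` C'. x <# U)"
        using p' by (auto simp: l_coset_def)
    qed
  qed
qed

end

text \<open>Finitely many translates of a finite set cannot cover an infinite group.\<close>

lemma infinite_neighbourhood_of_one:
  assumes "group G" "precompact_group G T" "infinite (carrier G)"
    and "openin T U" "\<one>\<^bsub>G\<^esub> \<in> U"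
  shows "infinite U"
proof
  assume "finite U"
  obtain F where F: "finite F" "carrier G \<subseteq> (\<Union>x\<in>F. x <#\<^bsub>G\<^esub> U)"
    using assms unfolding precompact_group_def by blast
  have "finite (\<Union>x\<in>F. x <#\<^bsub>G\<^esub> U)"
    using F \<open>finite U\<close> by (auto simp: l_coset_def)
  with F assms(3) show False
    using finite_subset by blast
qed

section \<open>The Pruefer 2-group and its characters\<close>

definition dyadic_roots :: "complex set" where
  "dyadic_roots = {z. \<exists>n::nat. z ^ 2 ^ n = 1}"

lemma dyadic_roots_eq_UN: "dyadic_roots = (\<Union>n. {z. z ^ 2 ^ n = 1})"
  by (auto simp: dyadic_roots_def)

lemma power_two_power_eq_one_mono:
  fixes z :: "'a::monoid_mult"
  assumes "z ^ 2 ^ m = 1" "m \<le> n"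
  shows "z ^ 2 ^ n = 1"
proof -
  have "2 ^ n = 2 ^ m * (2 ^ (n - m) :: nat)"
    using assms(2) by (simp flip: power_add)
  then show ?thesis
    using assms(1) by (simp add: power_mult)
qed

lemma dyadic_roots_common_exponent:
  assumes "z \<in> dyadic_roots" "w \<in> dyadic_roots"
  obtains n where "z ^ 2 ^ n = 1" "w ^ 2 ^ n = 1"
proof -
  obtain k l where "z ^ 2 ^ k = 1" "w ^ 2 ^ l = 1"
    using assms by (auto simp: dyadic_roots_def)
  then have "z ^ 2 ^ max k l = 1" "w ^ 2 ^ max k l = 1"
    using power_two_power_eq_one_mono max.cobounded1 max.cobounded2 by blast+
  then show ?thesis
    by (rule that)
qed

lemma one_in_dyadic_roots: "1 \<in> dyadic_roots"
  by (simp add: dyadic_roots_def)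

lemma mult_in_dyadic_roots:
  assumes "z \<in> dyadic_roots" "w \<in> dyadic_roots"
  shows "z * w \<in> dyadic_roots"
proof -
  obtain n where "z ^ 2 ^ n = 1" "w ^ 2 ^ n = 1"
    using assms by (rule dyadic_roots_common_exponent)
  then have "(z * w) ^ 2 ^ n = 1"
    by (simp add: power_mult_distrib)
  then show ?thesis
    by (auto simp: dyadic_roots_def)
qed

lemma inverse_in_dyadic_roots: "z \<in> dyadic_roots \<Longrightarrow> inverse z \<in> dyadic_roots"
  by (auto simp: dyadic_roots_def power_inverse)

lemma norm_dyadic_root: "z \<in> dyadic_roots \<Longrightarrow> norm z = 1"
  by (auto simp: dyadic_roots_def dest: power_eq_1_iff)

lemma countable_dyadic_roots: "countable dyadic_roots"
  unfolding dyadic_roots_eq_UN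
  by (rule countable_UN) (auto intro!: countable_finite finite_roots_unity simp: Suc_le_eq)

lemma infinite_dyadic_roots: "infinite dyadic_roots"
proof
  assume fin: "finite dyadic_roots"
  have "2 ^ n \<le> card dyadic_roots" for n
    using card_mono[OF fin, of "{z. z ^ 2 ^ n = 1}"] card_roots_unity_eq[of "2 ^ n"]
    by (auto simp: dyadic_roots_eq_UN)
  then show False
    by (meson less_exp not_less)
qed

text \<open>Just below the least exponent that gives 1 stands a square root of 1 other than 1. The
  resulting \<open>j\<close> records that \<open>z\<close> has order
  \<open>2 ^ Suc j\<close>.\<close>

lemma dyadic_root_level:
  fixes z :: complex
  assumes "z ^ 2 ^ n = 1" "z ^ 2 ^ m \<noteq> 1"
  obtains j where "m \<le> j" "j < n" "z ^ 2 ^ j = -1"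
proof -
  define k where "k = (LEAST k. z ^ 2 ^ k = 1)"
  have k: "z ^ 2 ^ k = 1"
    unfolding k_def using assms(1) by (rule LeastI)
  have "m < k"
    using k assms(2) power_two_power_eq_one_mono not_less by blast
  moreover have "k \<le> n"
    unfolding k_def using assms(1) by (rule Least_le)
  ultimately obtain j where j: "k = Suc j" "m \<le> j" "j < n"
    by (metis Suc_le_lessD less_Suc_eq_le old.nat.exhaust not_less_zero)
  have "z ^ 2 ^ j \<noteq> 1"
    using not_less_Least[of j "\<lambda>k. z ^ 2 ^ k = 1"] j unfolding k_def by auto
  moreover have "(z ^ 2 ^ j) ^ 2 = 1"
    using k j by (simp add: power_mult[symmetric] mult.commute)
  ultimately have "z ^ 2 ^ j = -1"
    by (simp add: power2_eq_1_iff)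
  with j that show ?thesis
    by blast
qed

text \<open>The assumption makes \<open>z\<close> a primitive root of order
  \<open>2 ^ Suc j\<close>. In the induction, a \<open>w\<close> with \<open>w ^ 2 ^ n = -1\<close>
  is multiplied by a power of \<open>z\<close> with the same property, which lowers its
  level.\<close>

lemma root_is_power_of_primitive_root:
  fixes z w :: complex
  assumes z: "z ^ 2 ^ j = -1"
  shows "w ^ 2 ^ n = 1 \<Longrightarrow> n \<le> Suc j \<Longrightarrow> \<exists>k. w = z ^ k"
proof (induction n arbitrary: w)
  case 0
  then show ?case
    by (auto intro: exI[of _ 0])
next
  case (Suc n)
  show ?case
  proof (cases "w ^ 2 ^ n = 1")
    case True
    then show ?thesis
      using Suc by simp
  next
    case False
    have "(w ^ 2 ^ n) ^ 2 = 1"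
      using Suc.prems by (simp add: power_mult[symmetric] mult.commute)
    with False have w: "w ^ 2 ^ n = -1"
      by (simp add: power2_eq_1_iff)
    define u where "u = z ^ 2 ^ (j - n)"
    have u: "u ^ 2 ^ n = -1"
      using z Suc.prems by (simp add: u_def power_mult[symmetric] power_add[symmetric])
    then have "(w * u) ^ 2 ^ n = 1"
      by (simp add: power_mult_distrib w)
    then obtain k where k: "w * u = z ^ k"
      using Suc by auto
    have "u ^ 2 ^ Suc n = 1"
      using u by (simp add: power_mult mult.commute[of 2])
    \<comment> \<open>The inverse of \<open>u\<close> is a natural power of \<open>u\<close>, so
      dividing by \<open>u\<close> still leaves a power of \<open>z\<close>.\<close>
    then have "u * u ^ (2 ^ Suc n - 1) = 1"
      by (metis power_eq_if power_not_zero zero_neq_numeral)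
    then have "w = z ^ k * u ^ (2 ^ Suc n - 1)"
      unfolding k[symmetric] by (simp add: mult.assoc)
    then show ?thesis
      unfolding u_def by (metis power_mult power_add)
  qed
qed

section \<open>Characters of the dyadic roots, given by 2-adic exponents\<close>

definition digit_sum :: "(nat \<Rightarrow> bool) \<Rightarrow> nat \<Rightarrow> nat" where
  "digit_sum a n = (\<Sum>i<n. of_bool (a i) * 2 ^ i)"

text \<open>The character \<open>z \<mapsto> z ^ c\<close> for the 2-adic integer c with binary digits a.\<close>

definition dyadic_char :: "complex \<Rightarrow> (nat \<Rightarrow> bool) \<Rightarrow> complex" where
  "dyadic_char z a = z ^ digit_sum a (LEAST n. z ^ 2 ^ n = 1)"

text \<open>Digits from position \<open>m\<close> on contribute multiples of \<open>2 ^ m\<close>,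
  which \<open>z\<close> does not see. Hence the character may be computed at any sufficiently large
  truncation.\<close>

lemma power_digit_sum_stable:
  fixes z :: "'a::comm_monoid_mult"
  assumes "z ^ 2 ^ m = 1" "m \<le> n"
  shows "z ^ digit_sum a n = z ^ digit_sum a m"
  using assms(2)
proof (induction n rule: dec_induct)
  case (step n)
  have "z ^ 2 ^ n = 1"
    using assms(1) step power_two_power_eq_one_mono by blast
  with step show ?case
    by (simp add: digit_sum_def power_add)
qed simp

lemma dyadic_char_eq:
  assumes "z ^ 2 ^ n = 1"
  shows "dyadic_char z a = z ^ digit_sum a n"
proof -
  have "z ^ 2 ^ (LEAST n. z ^ 2 ^ n = 1) = 1"
    using assms by (rule LeastI)
  moreover have "(LEAST n. z ^ 2 ^ n = 1) \<le> n"
    using assms by (rule Least_le)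
  ultimately show ?thesis
    unfolding dyadic_char_def by (rule power_digit_sum_stable[symmetric])
qed

lemma dyadic_char_mult:
  assumes "z \<in> dyadic_roots" "w \<in> dyadic_roots"
  shows "dyadic_char (z * w) a = dyadic_char z a * dyadic_char w a"
proof -
  obtain n where "z ^ 2 ^ n = 1" "w ^ 2 ^ n = 1"
    using assms by (rule dyadic_roots_common_exponent)
  then show ?thesis
    using dyadic_char_eq[of _ n a] by (simp add: power_mult_distrib)
qed

lemma norm_dyadic_char: "z \<in> dyadic_roots \<Longrightarrow> norm (dyadic_char z a) = 1"
  by (simp add: dyadic_char_def norm_power norm_dyadic_root)

text \<open>The 2-adic integer 1 gives the inclusion into the complex numbers, so the characters
  separate points.\<close>

lemma dyadic_char_one_digit:
  assumes "z \<in> dyadic_roots"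
  shows "dyadic_char z (\<lambda>i. i = 0) = z"
proof -
  obtain n where "z ^ 2 ^ n = 1"
    using assms by (auto simp: dyadic_roots_def)
  \<comment> \<open>Passing to \<open>Suc n\<close> ensures that digit 0 is counted even when
    \<open>n\<close> is 0.\<close>
  then have "z ^ 2 ^ Suc n = 1"
    using power_two_power_eq_one_mono[of z n "Suc n"] by simp
  moreover have "digit_sum (\<lambda>i. i = 0) (Suc n) = 1"
    unfolding digit_sum_def by (subst sum.lessThan_Suc_shift) simp
  ultimately show ?thesis
    using dyadic_char_eq by (metis power_one_right)
qed

text \<open>Greedy choice: setting digit \<open>i\<close> multiplies the power of \<open>y i\<close>
  by -1, and later digits do not enter \<open>digit_sum a (Suc i)\<close>.\<close>

lemma exists_nonpositive_digits:
  fixes y :: "nat \<Rightarrow> complex"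
  assumes y: "\<And>i. i \<in> I \<Longrightarrow> y i ^ 2 ^ i = -1"
  obtains a where "\<And>i. i \<notin> I \<Longrightarrow> \<not> a i"
    and "\<And>i. i \<in> I \<Longrightarrow> Re (y i ^ digit_sum a (Suc i)) \<le> 0"
proof -
  \<comment> \<open>\<open>f i\<close> is the exponent formed by the digits below \<open>i\<close>;
    digit \<open>i\<close> is set only if this exponent gives a positive real part.\<close>
  define f where "f = rec_nat 0 (\<lambda>i c. c + of_bool (i \<in> I \<and> Re (y i ^ c) > 0) * 2 ^ i)"
  have f: "f 0 = 0" "f (Suc i) = f i + of_bool (i \<in> I \<and> Re (y i ^ f i) > 0) * 2 ^ i" for i
    by (simp_all add: f_def)
  define a where "a i = (i \<in> I \<and> Re (y i ^ f i) > 0)" for i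
  have fa: "digit_sum a n = f n" for n
    by (induction n) (simp_all add: digit_sum_def f a_def)
  show ?thesis
  proof
    show "\<not> a i" if "i \<notin> I" for i
      using that by (simp add: a_def)
    show "Re (y i ^ digit_sum a (Suc i)) \<le> 0" if "i \<in> I" for i
      using that y by (auto simp: fa f power_add)
  qed
qed

text \<open>Strict growth will give each \<open>k\<close> a digit position of its own; the bound
  \<open>m\<close> will leave the low digits zero.\<close>

lemma exists_increasing_choice:
  fixes L :: "nat \<Rightarrow> nat set"
  assumes "\<And>k. infinite (L k)"
  obtains i where "strict_mono i" "\<And>k. i k \<in> L k" "\<And>k. m \<le> i k"
proof -
  have "\<exists>i. \<forall>k. (i k \<in> L k \<and> m \<le> i k) \<and> i k < i (Suc k)"
  proof (rule dependent_nat_choice)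
    show "\<exists>x. x \<in> L 0 \<and> m \<le> x"
      using assms[of 0] by (meson infinite_nat_iff_unbounded_le)
    show "\<exists>y. (y \<in> L (Suc k) \<and> m \<le> y) \<and> x < y" if "x \<in> L k \<and> m \<le> x" for x k
      using assms[of "Suc k"] that by (meson infinite_nat_iff_unbounded less_imp_le le_less_trans)
  qed
  then show ?thesis
    using that strict_mono_Suc_iff by blast
qed

section \<open>Quotients of the Pruefer 2-group\<close>

text \<open>The \<open>W k\<close> are preimages of a countable base at the identity coset. Only
  sets \<open>U\<close> stable under \<open>N\<close> are tested, since these are the preimages of
  sets of cosets.\<close>

lemma (in hausdorff_topological_group) first_countable_quotient_base:
  assumes N: "subgroup N G"
    and fc: "first_countable (quotient_group_topology G T N)"
  obtains W :: "nat \<Rightarrow> 'a set" where "\<And>k. openin T (W k)" "\<And>k. \<one> \<in> W k"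
    and "\<And>U. \<lbrakk>openin T U; \<one> \<in> U; \<And>x y. \<lbrakk>x \<in> U; y \<in> N\<rbrakk> \<Longrightarrow> y \<otimes> x \<in> U\<rbrakk> \<Longrightarrow> \<exists>k. W k \<subseteq> U"
proof -
  let ?Q = "quotient_group_topology G T N"
  have qm: "quotient_map T ?Q (\<lambda>x. N #> x)"
    by (rule quotient_map_quotient_group_topology)
  have oneQ: "N #> \<one> \<in> topspace ?Q"
    using quotient_imp_surjective_map[OF qm] topspace_carrier by blast
  then obtain B where B: "countable B" "\<And>V. V \<in> B \<Longrightarrow> openin ?Q V"
    "\<And>U. openin ?Q U \<Longrightarrow> N #> \<one> \<in> U \<Longrightarrow> \<exists>V\<in>B. N #> \<one> \<in> V \<and> V \<subseteq> U"
    using fc unfolding first_countable_def by metis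
  \<comment> \<open>Discarding the other members of \<open>B\<close> puts \<open>\<one>\<close> into
    every \<open>W k\<close>; the enumeration of \<open>B'\<close> may repeat members.\<close>
  define B' where "B' = {V \<in> B. N #> \<one> \<in> V}"
  have ne: "B' \<noteq> {}"
    using B(3)[OF openin_topspace oneQ] by (auto simp: B'_def)
  define W where "W k = {x \<in> topspace T. N #> x \<in> from_nat_into B' k}" for k
  have inB: "from_nat_into B' k \<in> B'" for k
    by (rule from_nat_into[OF ne])
  show ?thesis
  proof
    show "openin T (W k)" for k
      using inB[of k] B(2) by (auto simp: W_def B'_def openin_quotient_group_topology)
    show "\<one> \<in> W k" for k
      using inB[of k] by (auto simp: W_def B'_def topspace_carrier)
    fix U
    assume U: "openin T U" "\<one> \<in> U" and sat: "\<And>x y. \<lbrakk>x \<in> U; y \<in> N\<rbrakk> \<Longrightarrow> y \<otimes> x \<in> U"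
    have Ucar: "U \<subseteq> carrier G"
      using U(1) openin_subset topspace_carrier by blast
    \<comment> \<open>Being saturated, \<open>U\<close> is the full preimage of its image, which is
      therefore open in the quotient.\<close>
    have pre: "{x \<in> topspace T. N #> x \<in> (\<lambda>x. N #> x) ` U} = U"
    proof -
      have "x \<in> U" if x: "x \<in> carrier G" and u: "u \<in> U" and eq: "N #> x = N #> u" for x u
      proof -
        have "x \<in> N #> u"
          using rcos_self[OF x N] eq by simp
        then show ?thesis
          using sat[OF u] by (auto simp: r_coset_def)
      qed
      then show ?thesis
        using Ucar topspace_carrier by auto
    qed
    have "openin ?Q ((\<lambda>x. N #> x) ` U)"
      using U(1) Ucar pre by (auto simp: openin_quotient_group_topology FactGroup_def RCOSETS_def)
    then obtain V where V: "V \<in> B'" "V \<subseteq> (\<lambda>x. N #> x) ` U"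
      using B(3) U(2) unfolding B'_def by blast
    then obtain k where "from_nat_into B' k = V"
      using B(1) by (metis B'_def countable_Collect from_nat_into_surj)
    then have "W k \<subseteq> U"
      using V pre by (auto simp: W_def)
    then show "\<exists>k. W k \<subseteq> U" ..
  qed
qed

lemma (in group) card_FactGroup_carrier: "card (carrier (G Mod carrier G)) = 1"
proof -
  have "carrier G #> x = carrier G" if "x \<in> carrier G" for x
    using coset_join2[OF that subgroup_self that] .
  then have "carrier (G Mod carrier G) = {carrier G}"
    using one_closed by (auto simp: FactGroup_def RCOSETS_def)
  then show ?thesis
    by simp
qed

text \<open>The isomorphism \<open>e\<close> onto the dyadic roots leaves the carrier type free, as
  the final group lives on \<open>nat\<close>.\<close>

locale prufer_group = comm_group G
  for G (structure) +
  fixes e :: "'a \<Rightarrow> complex"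
  assumes bij_e: "bij_betw e (carrier G) dyadic_roots"
    and e_mult: "\<lbrakk>x \<in> carrier G; y \<in> carrier G\<rbrakk> \<Longrightarrow> e (x \<otimes> y) = e x * e y"
begin

lemma e_in_dyadic_roots [intro, simp]: "x \<in> carrier G \<Longrightarrow> e x \<in> dyadic_roots"
  using bij_e by (auto simp: bij_betw_def)

lemma e_inject: "\<lbrakk>x \<in> carrier G; y \<in> carrier G\<rbrakk> \<Longrightarrow> e x = e y \<longleftrightarrow> x = y"
  using bij_e by (auto simp: bij_betw_def inj_on_def)

text \<open>The index set consists of all digit sequences, so every 2-adic integer contributes a
  character.\<close>

sublocale separating_characters G "\<lambda>x. dyadic_char (e x)"
proof
  show "inj_on (\<lambda>x. dyadic_char (e x)) (carrier G)"
    by (rule inj_onI) (metis dyadic_char_one_digit e_in_dyadic_roots e_inject)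
qed (simp_all add: e_mult dyadic_char_mult norm_dyadic_char)

lemma e_one: "e \<one> = 1"
  using dyadic_char_one_digit[of "e \<one>"] char_one by simp

lemma e_pow: "x \<in> carrier G \<Longrightarrow> e (x [^] (k::nat)) = e x ^ k"
  by (induction k) (simp_all add: e_one e_mult mult.commute)

lemma infinite_carrier: "infinite (carrier G)"
  using bij_e infinite_dyadic_roots bij_betw_finite by blast

text \<open>Take \<open>g\<close> outside \<open>N\<close>, of order dividing \<open>2 ^ m\<close>.
  An element of \<open>N\<close> of larger order would have \<open>g\<close> among its
  powers.\<close>

lemma proper_subgroup_bounded:
  assumes N: "subgroup N G" and "N \<noteq> carrier G"
  obtains m where "\<And>x. x \<in> N \<Longrightarrow> e x ^ 2 ^ m = 1"
proof -
  obtain g where g: "g \<in> carrier G" "g \<notin> N"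
    using assms subgroup.subset by blast
  then obtain m where m: "e g ^ 2 ^ m = 1"
    using e_in_dyadic_roots[OF g(1)] by (auto simp: dyadic_roots_def)
  have "e x ^ 2 ^ m = 1" if x: "x \<in> N" for x
  proof (rule ccontr)
    assume ne: "e x ^ 2 ^ m \<noteq> 1"
    have xG: "x \<in> carrier G"
      using x N subgroup.subset by blast
    then obtain n where "e x ^ 2 ^ n = 1"
      using e_in_dyadic_roots[OF xG] by (auto simp: dyadic_roots_def)
    then obtain j where "m \<le> j" "e x ^ 2 ^ j = -1"
      using ne by (rule dyadic_root_level)
    then obtain k where "e g = e x ^ k"
      using root_is_power_of_primitive_root[of "e x" j "e g" m] m by auto
    then have "e g = e (x [^] k)"
      using e_pow[OF xG] by simp
    then have "g = x [^] k"
      using e_inject[OF g(1)] xG by blast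
    also have "x [^] k \<in> N"
      by (induction k) (use N x in \<open>simp_all add: subgroup.one_closed subgroup.m_closed\<close>)
    finally show False
      using g by simp
  qed
  then show ?thesis
    using that by blast
qed

text \<open>Finitely many levels would bound the orders in \<open>S\<close>, but only finitely many
  roots have bounded order.\<close>

lemma infinite_levels:
  assumes "S \<subseteq> carrier G" "infinite S"
  shows "infinite {j. \<exists>x\<in>S. e x ^ 2 ^ j = -1}"
proof
  assume "finite {j. \<exists>x\<in>S. e x ^ 2 ^ j = -1}"
  then obtain M where M: "\<And>j x. x \<in> S \<Longrightarrow> e x ^ 2 ^ j = -1 \<Longrightarrow> j < M"
    unfolding finite_nat_set_iff_bounded by blast
  have "e x ^ 2 ^ M = 1" if x: "x \<in> S" for x
  proof (rule ccontr)
    assume ne: "e x ^ 2 ^ M \<noteq> 1"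
    have "e x \<in> dyadic_roots"
      using x assms by auto
    then obtain n where "e x ^ 2 ^ n = 1"
      by (auto simp: dyadic_roots_def)
    then obtain j where "M \<le> j" "e x ^ 2 ^ j = -1"
      using ne by (rule dyadic_root_level)
    then show False
      using M[OF x] by fastforce
  qed
  then have "e ` S \<subseteq> {z. z ^ 2 ^ M = 1}"
    by auto
  then have "finite (e ` S)"
    using finite_roots_unity[of "2 ^ M"] finite_subset by auto
  moreover have "inj_on e S"
    using assms bij_e by (meson bij_betw_def inj_on_subset)
  ultimately show False
    using assms finite_imageD by blast
qed

lemma quotient_not_first_countable:
  assumes N: "subgroup N G" and proper: "N \<noteq> carrier G"
  shows "\<not> first_countable (quotient_group_topology G char_topology N)"
proof
  assume "first_countable (quotient_group_topology G char_topology N)"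
  then obtain W :: "nat \<Rightarrow> 'a set"
    where W: "\<And>k. openin char_topology (W k)" "\<And>k. \<one> \<in> W k"
      and base: "\<And>U. \<lbrakk>openin char_topology U; \<one> \<in> U; \<And>x y. \<lbrakk>x \<in> U; y \<in> N\<rbrakk> \<Longrightarrow> y \<otimes> x \<in> U\<rbrakk>
        \<Longrightarrow> \<exists>k. W k \<subseteq> U"
    using first_countable_quotient_base[OF N] by metis
  obtain m where m: "\<And>x. x \<in> N \<Longrightarrow> e x ^ 2 ^ m = 1"
    using proper_subgroup_bounded[OF N proper] by blast
  define L where "L k = {j. \<exists>x\<in>W k. e x ^ 2 ^ j = -1}" for k
  have "infinite (L k)" for k
    unfolding L_def
  proof (rule infinite_levels)
    show "W k \<subseteq> carrier G"
      using openin_subset[OF W(1)] by simp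
    show "infinite (W k)"
      using infinite_neighbourhood_of_one[OF is_group precompact_char_topology infinite_carrier W] .
  qed
  then obtain i where i: "strict_mono i" "\<And>k. i k \<in> L k" "\<And>k. m \<le> i k"
    using exists_increasing_choice[of L m] by blast
  have "\<forall>k. \<exists>x. x \<in> W k \<and> e x ^ 2 ^ i k = -1"
    using i(2) by (auto simp: L_def)
  from choice[OF this] obtain x where x: "\<And>k. x k \<in> W k" "\<And>k. e (x k) ^ 2 ^ i k = -1"
    by blast
  have inj: "inj i"
    using i(1) by (rule strict_mono_imp_inj_on)
  \<comment> \<open>Digit \<open>i k\<close> is reserved for \<open>x k\<close>, and
    \<open>inv_into\<close> recovers \<open>k\<close> from it; all digits outside
    \<open>range i\<close> vanish.\<close>
  obtain a where a0: "\<And>j. j \<notin> range i \<Longrightarrow> \<not> a j"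
    and a: "\<And>j. j \<in> range i \<Longrightarrow> Re (e (x (inv_into UNIV i j)) ^ digit_sum a (Suc j)) \<le> 0"
    by (rule exists_nonpositive_digits[of "range i" "\<lambda>j. e (x (inv_into UNIV i j))"])
      (use x inj in auto)
  have nonpos: "Re (dyadic_char (e (x k)) a) \<le> 0" for k
  proof -
    have "e (x k) ^ 2 ^ Suc (i k) = 1"
      using x(2)[of k] by (simp add: power_mult mult.commute[of 2])
    then show ?thesis
      using a[of "i k"] inj dyadic_char_eq[of "e (x k)" "Suc (i k)" a] by simp
  qed
  \<comment> \<open>On \<open>N\<close> only the digits below \<open>m\<close> matter, and these
    vanish because every \<open>i k\<close> is at least \<open>m\<close>.\<close>
  have trivial: "dyadic_char (e y) a = 1" if "y \<in> N" for y
  proof -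
    have "\<not> a j" if "j < m" for j
      using a0 i(3) that by (metis not_le rangeE)
    then have "digit_sum a m = 0"
      by (simp add: digit_sum_def)
    then show ?thesis
      using dyadic_char_eq[OF m[OF that]] by simp
  qed
  \<comment> \<open>Triviality of the character on \<open>N\<close> makes \<open>U\<close>
    saturated, while no \<open>x k\<close> belongs to \<open>U\<close>.\<close>
  define U where "U = {x \<in> carrier G. Re (dyadic_char (e x) a) > 0}"
  have "openin char_topology {x \<in> topspace char_topology. dyadic_char (e x) a \<in> {z. Re z > 0}}"
    by (rule openin_continuous_map_preimage[OF continuous_map_char])
      (simp add: open_halfspace_Re_gt)
  then have "openin char_topology U"
    by (simp add: U_def)
  moreover have "\<one> \<in> U"
    using char_one by (simp add: U_def)
  moreover have "y \<otimes> x \<in> U" if "x \<in> U" "y \<in> N" for x y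
    using that trivial subgroup.mem_carrier[OF N] char_mult by (simp add: U_def)
  ultimately obtain k where "W k \<subseteq> U"
    using base by blast
  then show False
    using x(1)[of k] nonpos[of k] by (auto simp: U_def)
qed

end

section \<open>The Pruefer 2-group transported to the natural numbers\<close>

definition prufer_nat :: "nat monoid" where
  "prufer_nat = \<lparr>carrier = UNIV,
     mult = (\<lambda>x y. to_nat_on dyadic_roots
       (from_nat_into dyadic_roots x * from_nat_into dyadic_roots y)),
     one = to_nat_on dyadic_roots 1\<rparr>"

interpretation prufer_nat: prufer_group prufer_nat "from_nat_into dyadic_roots"
proof -
  let ?e = "from_nat_into dyadic_roots" and ?t = "to_nat_on dyadic_roots"
  have bij: "bij_betw ?e UNIV dyadic_roots"
    by (rule bij_betw_from_nat_into[OF countable_dyadic_roots infinite_dyadic_roots])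
  have in_roots: "?e x \<in> dyadic_roots" for x
    using bij by (auto simp: bij_betw_def)
  have et: "?e (?t z) = z" if "z \<in> dyadic_roots" for z
    using that countable_dyadic_roots by simp
  have te: "?t (?e x) = x" for x
    using countable_dyadic_roots infinite_dyadic_roots by simp
  note closed = in_roots one_in_dyadic_roots mult_in_dyadic_roots inverse_in_dyadic_roots
  have "comm_group prufer_nat"
  proof (rule comm_groupI)
    fix x assume "x \<in> carrier prufer_nat"
    have "?e x \<noteq> 0"
      using norm_dyadic_root[OF in_roots[of x]] by auto
    then show "\<exists>y\<in>carrier prufer_nat. y \<otimes>\<^bsub>prufer_nat\<^esub> x = \<one>\<^bsub>prufer_nat\<^esub>"
      by (intro bexI[of _ "?t (inverse (?e x))"]) (simp_all add: prufer_nat_def et closed)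
  qed (simp_all add: prufer_nat_def et te closed ac_simps)
  then show "prufer_group prufer_nat ?e"
    unfolding prufer_group_def prufer_group_axioms_def
    using bij by (simp add: prufer_nat_def et closed)
qed

theorem proposition3p4:
  shows "\<exists>(H :: nat monoid) (T :: nat topology).
           comm_group H \<and> hausdorff_topological_group H T \<and>
           countable (carrier H) \<and> infinite (carrier H) \<and>
           precompact_group H T \<and>
           (\<forall>N. N \<lhd> H \<and> closedin T N \<longrightarrow>
              card (carrier (H Mod N)) = 1 \<or>
              \<not> metrizable_space (quotient_group_topology H T N))"
proof (rule exI[of _ prufer_nat], rule exI[of _ prufer_nat.char_topology], intro conjI allI impI)
  show "comm_group prufer_nat"
    by (rule prufer_nat.comm_group_axioms)
  show "hausdorff_topological_group prufer_nat prufer_nat.char_topology"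
    by (rule prufer_nat.hausdorff_topological_group_axioms)
  show "countable (carrier prufer_nat)"
    by (rule countableI_type)
  show "infinite (carrier prufer_nat)"
    by (rule prufer_nat.infinite_carrier)
  show "precompact_group prufer_nat prufer_nat.char_topology"
    by (rule prufer_nat.precompact_char_topology)
  fix N assume "N \<lhd> prufer_nat \<and> closedin prufer_nat.char_topology N"
  then have "subgroup N prufer_nat"
    by (simp add: normal_imp_subgroup)
  then show "card (carrier (prufer_nat Mod N)) = 1 \<or>
      \<not> metrizable_space (quotient_group_topology prufer_nat prufer_nat.char_topology N)"
    \<comment> \<open>The quotient by the whole group is trivial; any other quotient fails even
      first countability.\<close>
    using prufer_nat.quotient_not_first_countable prufer_nat.card_FactGroup_carrier
      metrizable_imp_first_countable by blast
qed

end
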